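(* Let $P$ be a finite nonempty set of objects with a metric $dist$, and let $w>0$ be any bin width. For every cut-off distance $d_c>0$, both of the following procedures (defined in the context) correctly compute the clusters of Density Peak Clustering (DPC) on $P$ with parameter $d_c$: (i) the List Index query; (ii) the Cumulative Histogram (CH) Index query with bin width $w$ for the local densities, followed by the $\delta$-part of the List Index query for the dependent distances. That is, for each of the two procedures and every $p\in P$, the returned values equal the local density $\rho_p$ and the dependent distance $\delta_p$ of DPC, and for every $p$ not of maximum density the returned object is a valid higher density neighbor $\mu_p$. Consequently, for every rule selecting cluster centers from the pairs $(\rho_p,\delta_p)_{p\in P}$, the resulting set of clusters is a DPC clustering of $P$ for $d_c$ under that rule.
   Context: **Density Peak Clustering (DPC).** For $p\in P$, the local density is $\rho_p=\#\{q\in P: dist(p,q)<d_c\}$ (the sum over $q\in P$ of $\chi(dist(p,q)-d_c)$, where $\chi(x)=1$ if $x<0$ and $\chi(x)=0$ otherwise). If some $q\in P$ has $\rho_q>\rho_p$, the dependent distance is $\delta_p=\min\{dist(p,q): q\in P,\ q\neq p,\ \rho_q>\rho_p\}$, and a (valid) higher density neighbor $\mu_p$ is any object attaining this minimum. If $p$ has maximum density (a global peak), then $\delta_p=\max_{q\in P}dist(p,q)$ and $\mu_p$ is undefined. Cluster centers are a subset $C\subseteq P$ chosen by some rule depending on the values $(\rho_p,\delta_p)_{p\in P}$ (a "decision graph" read by the user: high $\rho$ and large $\delta$). Each center starts its own cluster, and every non-center $p$ having a $\mu_p$ is assigned to the cluster containing $\mu_p$ (if any). A DPC clustering for a given rule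 is any set of clusters obtained this way from the exact values $\rho_p,\delta_p$ and some choice of valid $\mu_p$. **List Index.** For each $p\in P$, N-List$(p)$ is the list of all objects $q\in P$, with their distances $dist(p,q)$, sorted in non-decreasing order of $dist(p,q)$. Positions are numbered from $0$. **List Index query (input: List Index, $d_c$).** - $\rho$-part: for each $p$, a binary search over N-List$(p)$ locates the last entry with distance $<d_c$, and the number of entries up to and including it is returned as $\rho_p$. - $\delta$-part: for each $p$, scan N-List$(p)$ from the start and stop at the first $q$ with $\rho_q>\rho_p$ (using the computed densities). Return $\delta_p=dist(p,q)$ and $\mu_p=q$. If there is no such $q$, return $\delta_p=\max_{q\in P}dist(p,q)$. **CH Index with bin width $w$.** For each $p$, the CH Index stores the list $H_p[0],H_p[1],\dots,H_p[m_p-1]$, where $H_p[k]$ is the number of entries of N-List$(p)$ with distance less than $(k+1)w$, and $m_p$ is the least positive integer such that all entries of N-List$(p)$ have distance less than $m_p w$. **CH Index query for $\rho$ (input: CH Index, $d_c$).** Let $b=d_c/w$ and $T=\lfloor b\rfloor$. For each $p$: - if $T\ge m_p$, return $\rho_p=H_p[m_p-1]$; - if $T<m_p$ and $b=T$, return $\rho_p=H_p[T-1]$; - if $T<m_p$ and $b\ne T$, let $first=0$ if $T=0$ and $first=H_p[T-1]$ otherwise, and let $last=H_p[T]-1$. Search positions $first,\dots,last$ of N-List$(p)$ for the last entry with distance $<d_c$, and return as $\rho_p$ the number of entries of N-List$(p)$ up to and including it (return $first$ if no entry in this section has distance $<d_c$). *)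

theory Defs
  imports "HOL-Analysis.Analysis"
begin

section \<open>Density Peak Clustering\<close>

definition local_density :: "'a set \<Rightarrow> ('a \<Rightarrow> 'a \<Rightarrow> real) \<Rightarrow> real \<Rightarrow> 'a \<Rightarrow> nat" where
  "local_density P d dc p = card {q \<in> P. d p q < dc}"

definition higher_density :: "'a set \<Rightarrow> ('a \<Rightarrow> 'a \<Rightarrow> real) \<Rightarrow> real \<Rightarrow> 'a \<Rightarrow> 'a set" where
  "higher_density P d dc p =
     {q \<in> P. q \<noteq> p \<and> local_density P d dc p < local_density P d dc q}"

definition dependent_distance :: "'a set \<Rightarrow> ('a \<Rightarrow> 'a \<Rightarrow> real) \<Rightarrow> real \<Rightarrow> 'a \<Rightarrow> real" where
  "dependent_distance P d dc p =
     (if higher_density P d dc p \<noteq> {} then Min (d p ` higher_density P d dc p)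
      else Max (d p ` P))"

definition higher_density_neighbor ::
    "'a set \<Rightarrow> ('a \<Rightarrow> 'a \<Rightarrow> real) \<Rightarrow> real \<Rightarrow> 'a \<Rightarrow> 'a \<Rightarrow> bool" where
  "higher_density_neighbor P d dc p q \<longleftrightarrow>
     q \<in> higher_density P d dc p \<and> d p q = dependent_distance P d dc p"

text \<open>A neighbor assignment is a partial function: it is undefined (\<open>None\<close>) exactly
  on the objects of maximum density.\<close>

definition valid_neighbors ::
    "'a set \<Rightarrow> ('a \<Rightarrow> 'a \<Rightarrow> real) \<Rightarrow> real \<Rightarrow> ('a \<Rightarrow> 'a option) \<Rightarrow> bool" where
  "valid_neighbors P d dc \<mu> \<longleftrightarrow>
     (\<forall>p\<in>P. case \<mu> p of
        None \<Rightarrow> higher_density P d dc p = {}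
      | Some q \<Rightarrow> higher_density_neighbor P d dc p q)"

text \<open>\<open>in_cluster P C \<mu> c p\<close>: the object \<open>p\<close> belongs to the cluster started by the center \<open>c\<close>.
  An object whose chain of neighbors reaches no center belongs to no cluster.\<close>

inductive in_cluster ::
    "'a set \<Rightarrow> 'a set \<Rightarrow> ('a \<Rightarrow> 'a option) \<Rightarrow> 'a \<Rightarrow> 'a \<Rightarrow> bool"
  for P C \<mu> c where
    center: "c \<in> C \<Longrightarrow> in_cluster P C \<mu> c c"
  | follow: "p \<in> P \<Longrightarrow> p \<notin> C \<Longrightarrow> \<mu> p = Some q \<Longrightarrow> in_cluster P C \<mu> c q
               \<Longrightarrow> in_cluster P C \<mu> c p"

definition clusters :: "'a set \<Rightarrow> 'a set \<Rightarrow> ('a \<Rightarrow> 'a option) \<Rightarrow> 'a set set" where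
  "clusters P C \<mu> = (\<lambda>c. {p. in_cluster P C \<mu> c p}) ` C"

text \<open>A rule maps the family of pairs (density, dependent distance) indexed by \<open>P\<close> to a set
  of centers. Families are restricted to \<open>P\<close>, so that a rule cannot depend on
  values outside \<open>P\<close>.\<close>

type_synonym 'a center_rule = "('a \<Rightarrow> nat \<times> real) \<Rightarrow> 'a set"

definition is_center_rule :: "'a set \<Rightarrow> 'a center_rule \<Rightarrow> bool" where
  "is_center_rule P R \<longleftrightarrow> (\<forall>f \<in> extensional P. R f \<subseteq> P)"

definition centers :: "'a set \<Rightarrow> 'a center_rule \<Rightarrow> ('a \<Rightarrow> nat) \<Rightarrow> ('a \<Rightarrow> real) \<Rightarrow> 'a set" where
  "centers P R \<rho> \<delta> = R (\<lambda>p\<in>P. (\<rho> p, \<delta> p))"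

definition dpc_clustering ::
    "'a set \<Rightarrow> ('a \<Rightarrow> 'a \<Rightarrow> real) \<Rightarrow> real \<Rightarrow> 'a center_rule \<Rightarrow> 'a set set \<Rightarrow> bool" where
  "dpc_clustering P d dc R K \<longleftrightarrow>
     (\<exists>\<mu>. valid_neighbors P d dc \<mu> \<and>
          K = clusters P (centers P R (local_density P d dc) (dependent_distance P d dc)) \<mu>)"


section \<open>List Index\<close>

text \<open>An entry is an object together with its distance. The order of entries
  with equal distance is left open.\<close>

type_synonym 'a list_index = "'a \<Rightarrow> ('a \<times> real) list"

definition is_list_index ::
    "'a set \<Rightarrow> ('a \<Rightarrow> 'a \<Rightarrow> real) \<Rightarrow> 'a list_index \<Rightarrow> bool" where
  "is_list_index P d N \<longleftrightarrow>
     (\<forall>p\<in>P. distinct (N p) \<and> set (N p) = (\<lambda>q. (q, d p q)) ` P \<and> sorted (map snd (N p)))"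

text \<open>Binary search in the positions \<open>lo..<hi\<close>. The result is one more than the position of
  the last entry with distance below \<open>dc\<close>, hence the number of entries up to and including it.\<close>

function binary_search :: "('a \<times> real) list \<Rightarrow> real \<Rightarrow> nat \<Rightarrow> nat \<Rightarrow> nat" where
  "binary_search xs dc lo hi =
     (if lo < hi then
        let mid = (lo + hi) div 2
        in if snd (xs ! mid) < dc then binary_search xs dc (Suc mid) hi
           else binary_search xs dc lo mid
      else lo)"
  by pat_completeness auto
termination
  by (relation "Wellfounded.measure (\<lambda>(xs, dc, lo, hi). hi - lo)") auto

declare binary_search.simps [simp del]

definition list_rho :: "'a list_index \<Rightarrow> real \<Rightarrow> 'a \<Rightarrow> nat" where
  "list_rho N dc p = binary_search (N p) dc 0 (length (N p))"

definition scan :: "'a list_index \<Rightarrow> ('a \<Rightarrow> nat) \<Rightarrow> 'a \<Rightarrow> ('a \<times> real) option" where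
  "scan N \<rho> p = find (\<lambda>e. \<rho> p < \<rho> (fst e)) (N p)"

definition list_delta :: "'a list_index \<Rightarrow> ('a \<Rightarrow> nat) \<Rightarrow> 'a \<Rightarrow> real" where
  "list_delta N \<rho> p =
     (case scan N \<rho> p of Some e \<Rightarrow> snd e | None \<Rightarrow> Max (snd ` set (N p)))"

definition list_mu :: "'a list_index \<Rightarrow> ('a \<Rightarrow> nat) \<Rightarrow> 'a \<Rightarrow> 'a option" where
  "list_mu N \<rho> p = map_option fst (scan N \<rho> p)"

type_synonym 'a query_result = "('a \<Rightarrow> nat) \<times> ('a \<Rightarrow> real) \<times> ('a \<Rightarrow> 'a option)"

definition list_index_query :: "'a list_index \<Rightarrow> real \<Rightarrow> 'a query_result" where
  "list_index_query N dc =
     (let \<rho> = list_rho N dc in (\<rho>, list_delta N \<rho>, list_mu N \<rho>))"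


section \<open>Cumulative Histogram Index\<close>

type_synonym 'a ch_index = "'a \<Rightarrow> nat list"

definition num_bins :: "real \<Rightarrow> ('a \<times> real) list \<Rightarrow> nat" where
  "num_bins w xs = (LEAST m. 0 < m \<and> (\<forall>e\<in>set xs. snd e < real m * w))"

definition ch_index :: "real \<Rightarrow> 'a list_index \<Rightarrow> 'a ch_index" where
  "ch_index w N p =
     map (\<lambda>k. length (filter (\<lambda>e. snd e < real (k + 1) * w) (N p))) [0..<num_bins w (N p)]"

text \<open>Search in a section \<open>lo..<hi\<close> for the last entry with distance below \<open>dc\<close>, with the result
  specified independently of the search strategy.\<close>

definition search_section :: "('a \<times> real) list \<Rightarrow> real \<Rightarrow> nat \<Rightarrow> nat \<Rightarrow> nat" where
  "search_section xs dc lo hi =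
     (let S = {i \<in> {lo..<hi}. snd (xs ! i) < dc} in if S = {} then lo else Suc (Max S))"

text \<open>The section between the positions \<open>first\<close> and \<open>last = H ! T - 1\<close> is passed in half-open
  form, which avoids the truncated subtraction.\<close>

definition ch_rho :: "real \<Rightarrow> 'a ch_index \<Rightarrow> 'a list_index \<Rightarrow> real \<Rightarrow> 'a \<Rightarrow> nat" where
  "ch_rho w CH N dc p =
     (let H = CH p; m = length H; b = dc / w; T = nat \<lfloor>b\<rfloor> in
      if m \<le> T then H ! (m - 1)
      else if b = real T then H ! (T - 1)
      else search_section (N p) dc (if T = 0 then 0 else H ! (T - 1)) (H ! T))"

definition ch_index_query ::
    "real \<Rightarrow> 'a ch_index \<Rightarrow> 'a list_index \<Rightarrow> real \<Rightarrow> 'a query_result" where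
  "ch_index_query w CH N dc =
     (let \<rho> = ch_rho w CH N dc in (\<rho>, list_delta N \<rho>, list_mu N \<rho>))"


section \<open>Correctness of a query\<close>

definition correct_values ::
    "'a set \<Rightarrow> ('a \<Rightarrow> 'a \<Rightarrow> real) \<Rightarrow> real \<Rightarrow> 'a query_result \<Rightarrow> bool" where
  "correct_values P d dc = (\<lambda>(\<rho>, \<delta>, \<mu>).
     \<forall>p\<in>P. \<rho> p = local_density P d dc p \<and> \<delta> p = dependent_distance P d dc p \<and>
       ((\<exists>q\<in>P. local_density P d dc p < local_density P d dc q) \<longrightarrow>
          (\<exists>q. \<mu> p = Some q \<and> higher_density_neighbor P d dc p q)))"

definition correct_clusters ::
    "'a set \<Rightarrow> ('a \<Rightarrow> 'a \<Rightarrow> real) \<Rightarrow> real \<Rightarrow> 'a query_result \<Rightarrow> bool" where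
  "correct_clusters P d dc = (\<lambda>(\<rho>, \<delta>, \<mu>).
     \<forall>R. is_center_rule P R \<longrightarrow> dpc_clustering P d dc R (clusters P (centers P R \<rho> \<delta>) \<mu>))"

end

theory Submission
  imports Defs
begin

text \<open>In a sorted list the entries with distance below a bound form an initial segment, so every
  search confined to a section that contains the end of this segment returns its length. The bins
  adjacent to the cut-off distance delimit such a section. Once the densities are exact, the first
  entry of higher density in the sorted list is a nearest one.\<close>

text \<open>The common value of both searches and of the histogram entries; for the list of an
  object of \<open>P\<close> it turns out to be the local density.\<close>

definition count_below :: "('a \<times> real) list \<Rightarrow> real \<Rightarrow> nat" where
  "count_below xs x = length (filter (\<lambda>e. snd e < x) xs)"

lemma count_below_le_length: "count_below xs x \<le> length xs"
  by (simp add: count_below_def)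

lemma count_below_mono: "x \<le> y \<Longrightarrow> count_below xs x \<le> count_below xs y"
  by (induction xs) (auto simp: count_below_def)

lemma count_below_eq_length: "(\<And>e. e \<in> set xs \<Longrightarrow> snd e < x) \<Longrightarrow> count_below xs x = length xs"
  by (simp add: count_below_def)

text \<open>If the head is below \<open>x\<close>, both sides shift by one position. Otherwise
  sortedness keeps every entry from being below \<open>x\<close>, and the count is zero.\<close>

lemma nth_less_iff_count_below:
  assumes "sorted (map snd xs)" and "i < length xs"
  shows "snd (xs ! i) < x \<longleftrightarrow> i < count_below xs x"
  using assms
proof (induction xs arbitrary: i)
  case Nil
  then show ?case by simp
next
  case (Cons a xs)
  show ?case
  proof (cases "snd a < x")
    case True
    with Cons show ?thesis
      by (cases i) (auto simp: count_below_def)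
  next
    case False
    with Cons.prems(1) have ge: "\<forall>e\<in>set (a # xs). \<not> snd e < x" by auto
    then have "count_below (a # xs) x = 0" by (simp add: count_below_def)
    with ge Cons.prems(2) nth_mem show ?thesis by (metis not_less_zero)
  qed
qed

text \<open>The invariant is that the count lies between \<open>lo\<close> and \<open>hi\<close>.
  The comparison at \<open>mid\<close> tells which half keeps it, and the two bounds meet at the
  count.\<close>

lemma binary_search_eq_count_below:
  assumes "sorted (map snd xs)"
    and "lo \<le> count_below xs dc" and "count_below xs dc \<le> hi" and "hi \<le> length xs"
  shows "binary_search xs dc lo hi = count_below xs dc"
  using assms
proof (induction xs dc lo hi rule: binary_search.induct)
  case (1 xs dc lo hi)
  show ?case
  proof (cases "lo < hi")
    case False
    with 1 show ?thesis by (simp add: binary_search.simps)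
  next
    case True
    define mid where "mid = (lo + hi) div 2"
    have "mid < length xs" using True 1 by (simp add: mid_def)
    then have "snd (xs ! mid) < dc \<longleftrightarrow> mid < count_below xs dc"
      using 1 by (intro nth_less_iff_count_below)
    moreover have "mid \<le> hi" using True by (simp add: mid_def)
    ultimately show ?thesis
      using True 1 by (subst binary_search.simps) (auto simp: Let_def mid_def)
  qed
qed

lemma search_section_eq_count_below:
  assumes "sorted (map snd xs)"
    and "lo \<le> count_below xs dc" and "count_below xs dc \<le> hi" and "hi \<le> length xs"
  shows "search_section xs dc lo hi = count_below xs dc"
proof -
  have "{i \<in> {lo..<hi}. snd (xs ! i) < dc} = {lo..<count_below xs dc}"
    using assms by (auto simp: nth_less_iff_count_below)
  moreover have "Suc (Max {lo..<count_below xs dc}) = count_below xs dc"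
    if "lo < count_below xs dc"
  proof -
    have "Max {lo..<count_below xs dc} = count_below xs dc - 1"
      using that by (intro Max_eqI) auto
    then show ?thesis using that by simp
  qed
  \<comment> \<open>If the section has no entry below \<open>dc\<close>, then \<open>lo\<close> is
    already the count, so the default value is right.\<close>
  ultimately show ?thesis
    using assms(2) by (auto simp: search_section_def)
qed

lemma num_bins_spec:
  assumes "w > 0"
  shows "0 < num_bins w xs" and "\<And>e. e \<in> set xs \<Longrightarrow> snd e < real (num_bins w xs) * w"
proof -
  \<comment> \<open>Inserting \<open>0\<close> covers the empty list and also forces
    \<open>n\<close> to be positive.\<close>
  obtain n where n: "Max (insert 0 (snd ` set xs)) < real n * w"
    using reals_Archimedean3[OF assms] by blast
  then have "0 < n \<and> (\<forall>e\<in>set xs. snd e < real n * w)"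
    by (auto intro!: gr0I)
  then have *: "0 < num_bins w xs \<and> (\<forall>e\<in>set xs. snd e < real (num_bins w xs) * w)"
    unfolding num_bins_def by (rule LeastI)
  show "0 < num_bins w xs" using * by blast
  show "\<And>e. e \<in> set xs \<Longrightarrow> snd e < real (num_bins w xs) * w" using * by blast
qed

lemma ch_index_nth:
  "k < num_bins w (N p) \<Longrightarrow> ch_index w N p ! k = count_below (N p) (real (k + 1) * w)"
  by (simp add: ch_index_def count_below_def)

lemma length_ch_index: "length (ch_index w N p) = num_bins w (N p)"
  by (simp add: ch_index_def)

text \<open>Histogram entries are counts below multiples of \<open>w\<close>. A cut-off past the
  last bin counts everything, one on a bin border is a stored count, and any other is bracketed by
  the counts at the two borders of its bin.\<close>

lemma ch_rho_eq_count_below: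
  assumes "sorted (map snd (N p))" and w: "w > 0" and dc: "dc > 0"
  shows "ch_rho w (ch_index w N) N dc p = count_below (N p) dc"
proof -
  define m where "m = num_bins w (N p)"
  define T where "T = nat \<lfloor>dc / w\<rfloor>"
  have m: "0 < m" "\<And>e. e \<in> set (N p) \<Longrightarrow> snd e < real m * w"
    using num_bins_spec[OF w] unfolding m_def by blast+
  \<comment> \<open>Since \<open>dc / w\<close> is positive, \<open>nat\<close> does not truncate
    its floor.\<close>
  have "real T \<le> dc / w" "dc / w < real (T + 1)"
    using w dc unfolding T_def by (simp, linarith)
  then have T: "real T * w \<le> dc" "dc < real (T + 1) * w"
    using w by (simp_all add: field_simps)
  have H: "ch_index w N p ! k = count_below (N p) (real (k + 1) * w)" if "k < m" for k
    using that unfolding m_def by (rule ch_index_nth)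
  note unfolded = ch_rho_def Let_def length_ch_index m_def[symmetric] T_def[symmetric]
  consider "m \<le> T" | "T < m" "dc / w = real T" | "T < m" "dc / w \<noteq> real T"
    by linarith
  then show ?thesis
  proof cases
    case 1
    then have "real m * w \<le> dc"
      using w T(1) by (meson mult_right_mono less_imp_le of_nat_le_iff order_trans)
    then have "count_below (N p) dc = length (N p)"
      using m(2) by (intro count_below_eq_length) force
    moreover have "ch_index w N p ! (m - 1) = length (N p)"
      using m by (simp add: H count_below_eq_length)
    ultimately show ?thesis using 1 by (simp add: unfolded)
  next
    case 2
    \<comment> \<open>Positivity of \<open>T\<close> makes \<open>T - 1\<close> a genuine
      predecessor, so the entry at \<open>T - 1\<close> counts below exactly
      \<open>dc\<close>.\<close>
    then have "dc = real T * w" "0 < T" using w dc by (auto simp: field_simps intro!: gr0I)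
    then show ?thesis using 2 H[of "T - 1"] by (simp add: unfolded)
  next
    case 3
    define lo where "lo = (if T = 0 then 0 else ch_index w N p ! (T - 1))"
    have "lo \<le> count_below (N p) dc"
      using 3 T(1) H[of "T - 1"] by (auto simp: lo_def intro!: count_below_mono)
    moreover have "count_below (N p) dc \<le> ch_index w N p ! T"
      using 3 T(2) by (simp add: H count_below_mono)
    moreover have "ch_index w N p ! T \<le> length (N p)"
      using 3 by (simp add: H count_below_le_length)
    ultimately have "search_section (N p) dc lo (ch_index w N p ! T) = count_below (N p) dc"
      using assms(1) by (intro search_section_eq_count_below)
    then show ?thesis
      using 3 by (simp add: unfolded lo_def split: if_splits)
  qed
qed

text \<open>Entries carry their object, so pairing with the distance is injective and objects at
  equal distance are counted separately.\<close>

lemma count_below_eq_local_density: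
  assumes "is_list_index P d N" and "p \<in> P"
  shows "count_below (N p) dc = local_density P d dc p"
proof -
  have "distinct (N p)" and set: "set (N p) = (\<lambda>q. (q, d p q)) ` P"
    using assms by (auto simp: is_list_index_def)
  then have "count_below (N p) dc = card (set (filter (\<lambda>e. snd e < dc) (N p)))"
    unfolding count_below_def by (intro distinct_card[symmetric]) simp
  also have "set (filter (\<lambda>e. snd e < dc) (N p)) = (\<lambda>q. (q, d p q)) ` {q \<in> P. d p q < dc}"
    by (auto simp: set)
  also have "card \<dots> = local_density P d dc p"
    unfolding local_density_def by (intro card_image) (simp add: inj_on_def)
  finally show ?thesis .
qed

text \<open>Every entry before the one found fails \<open>Q\<close>, so \<open>e'\<close> cannot
  precede \<open>e\<close>.\<close>

lemma find_sorted_minimal: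
  assumes "sorted (map f xs)" and "find Q xs = Some e" and "e' \<in> set xs" and "Q e'"
  shows "f e \<le> f e'"
  using assms by (induction xs) (auto split: if_splits)

lemma delta_part_Some:
  assumes "finite P" and N: "is_list_index P d N" and p: "p \<in> P"
    and \<rho>: "\<And>q. q \<in> P \<Longrightarrow> \<rho> q = local_density P d dc q"
    and e: "scan N \<rho> p = Some e"
  shows "higher_density_neighbor P d dc p (fst e)" and "snd e = dependent_distance P d dc p"
proof -
  have set: "set (N p) = (\<lambda>q. (q, d p q)) ` P" and sorted: "sorted (map snd (N p))"
    using N p by (auto simp: is_list_index_def)
  have find: "find (\<lambda>e. \<rho> p < \<rho> (fst e)) (N p) = Some e"
    using e by (simp add: scan_def)
  then have "e \<in> set (N p)" "\<rho> p < \<rho> (fst e)"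
    by (auto simp: find_Some_iff)
  \<comment> \<open>The object found differs from \<open>p\<close> because its density is strictly
    larger.\<close>
  then have mem: "fst e \<in> higher_density P d dc p" and dist: "snd e = d p (fst e)"
    using p \<rho> by (auto simp: set higher_density_def)
  have "snd e \<le> d p q" if "q \<in> higher_density P d dc p" for q
    using find_sorted_minimal[OF sorted find, of "(q, d p q)"] that p \<rho>
    by (auto simp: set higher_density_def)
  moreover have "finite (higher_density P d dc p)"
    using assms(1) by (simp add: higher_density_def)
  ultimately have "Min (d p ` higher_density P d dc p) = snd e"
    using mem dist by (intro Min_eqI) auto
  then show *: "snd e = dependent_distance P d dc p"
    using mem by (auto simp: dependent_distance_def)
  show "higher_density_neighbor P d dc p (fst e)"
    using mem dist * by (simp add: higher_density_neighbor_def)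
qed

lemma delta_part_None:
  assumes N: "is_list_index P d N" and p: "p \<in> P"
    and \<rho>: "\<And>q. q \<in> P \<Longrightarrow> \<rho> q = local_density P d dc q"
    and none: "scan N \<rho> p = None"
  shows "higher_density P d dc p = {}" and "Max (snd ` set (N p)) = dependent_distance P d dc p"
proof -
  have set: "set (N p) = (\<lambda>q. (q, d p q)) ` P"
    using N p by (auto simp: is_list_index_def)
  show *: "higher_density P d dc p = {}"
    using none p \<rho> by (auto simp: scan_def find_None_iff set higher_density_def)
  show "Max (snd ` set (N p)) = dependent_distance P d dc p"
    by (simp add: * dependent_distance_def set image_image)
qed

lemma list_delta_correct:
  assumes "finite P" and "is_list_index P d N" and "p \<in> P"
    and "\<And>q. q \<in> P \<Longrightarrow> \<rho> q = local_density P d dc q"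
  shows "list_delta N \<rho> p = dependent_distance P d dc p"
  using delta_part_Some(2)[OF assms] delta_part_None(2)[OF assms(2-4)]
  by (simp add: list_delta_def split: option.split)

lemma list_mu_valid:
  assumes "finite P" and "is_list_index P d N"
    and "\<And>q. q \<in> P \<Longrightarrow> \<rho> q = local_density P d dc q"
  shows "valid_neighbors P d dc (list_mu N \<rho>)"
  unfolding valid_neighbors_def list_mu_def
  using delta_part_Some(1)[OF assms(1,2) _ assms(3)] delta_part_None(1)[OF assms(2) _ assms(3)]
  by (simp split: option.split)

text \<open>The two queries differ only in how they obtain \<open>\<rho>\<close>, so exact densities
  on \<open>P\<close> are all that remains to be checked for each.\<close>

lemma query_correct:
  assumes "finite P" and "is_list_index P d N"
    and \<rho>: "\<And>q. q \<in> P \<Longrightarrow> \<rho> q = local_density P d dc q"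
  shows "correct_values P d dc (\<rho>, list_delta N \<rho>, list_mu N \<rho>)"
    and "correct_clusters P d dc (\<rho>, list_delta N \<rho>, list_mu N \<rho>)"
proof -
  have \<delta>: "list_delta N \<rho> p = dependent_distance P d dc p" if "p \<in> P" for p
    using assms(1,2) that \<rho> by (rule list_delta_correct)
  have \<mu>: "valid_neighbors P d dc (list_mu N \<rho>)"
    using assms by (rule list_mu_valid)
  have "\<exists>q. list_mu N \<rho> p = Some q \<and> higher_density_neighbor P d dc p q"
    if "p \<in> P" "\<exists>q\<in>P. local_density P d dc p < local_density P d dc q" for p
  proof -
    have "higher_density P d dc p \<noteq> {}" using that by (auto simp: higher_density_def)
    then show ?thesis
      using \<mu> that(1) by (cases "list_mu N \<rho> p") (force simp: valid_neighbors_def)+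
  qed
  then show "correct_values P d dc (\<rho>, list_delta N \<rho>, list_mu N \<rho>)"
    by (simp add: correct_values_def \<rho> \<delta>)
  \<comment> \<open>A rule sees only the family restricted to \<open>P\<close>, so agreement on
    \<open>P\<close> yields the same centers; \<open>list_mu N \<rho>\<close> itself then witnesses
    the clustering.\<close>
  have "centers P R \<rho> (list_delta N \<rho>) =
      centers P R (local_density P d dc) (dependent_distance P d dc)" for R
    unfolding centers_def by (rule arg_cong[of _ _ R]) (simp add: \<rho> \<delta> cong: restrict_cong)
  with \<mu> show "correct_clusters P d dc (\<rho>, list_delta N \<rho>, list_mu N \<rho>)"
    by (auto simp: correct_clusters_def dpc_clustering_def)
qed

theorem theorem3:
  fixes P :: "'a set" and d :: "'a \<Rightarrow> 'a \<Rightarrow> real" and w dc :: real and N :: "'a list_index"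
  assumes "Metric_space P d" and "finite P" and "P \<noteq> {}"
    and "w > 0" and "dc > 0"
    and "is_list_index P d N"
  shows "correct_values P d dc (list_index_query N dc) \<and>
         correct_clusters P d dc (list_index_query N dc) \<and>
         correct_values P d dc (ch_index_query w (ch_index w N) N dc) \<and>
         correct_clusters P d dc (ch_index_query w (ch_index w N) N dc)"
proof -
  have sorted: "sorted (map snd (N p))" if "p \<in> P" for p
    using assms(6) that by (simp add: is_list_index_def)
  have list: "list_rho N dc p = local_density P d dc p" if "p \<in> P" for p
    \<comment> \<open>The search starts on the whole list, where the bounds on the count are
      trivial.\<close>
    using binary_search_eq_count_below[OF sorted[OF that]]
      count_below_eq_local_density[OF assms(6) that]
    by (metis list_rho_def count_below_le_length le0 le_refl)
  have ch: "ch_rho w (ch_index w N) N dc p = local_density P d dc p" if "p \<in> P" for p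
    using ch_rho_eq_count_below[where N = N, OF sorted[OF that] assms(4,5)]
      count_below_eq_local_density[OF assms(6) that] by simp
  show ?thesis
    unfolding list_index_query_def ch_index_query_def Let_def
    using query_correct[OF assms(2,6) list] query_correct[OF assms(2,6) ch] by blast
qed

end
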